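(* Let $(\mathcal A,\cdot)$ be a $\delta$-mock-Novikov algebra over a field of characteristic different from $2$, where $\delta$ is a nonzero scalar of the field; write $xy$ for $x\cdot y$. For all $x,y\in\mathcal A$, define $$x\ast y=\frac{xy-yx}{2},\qquad x\circ y=\frac{xy+yx}{2}.$$ Then $(\mathcal A,\ast,\circ)$ is a $\delta$-mock-Novikov-Poisson algebra if and only if $$x(yz)-z(yx)-(1+\delta)(xz)y+(1-\delta)(zx)y=0\qquad\text{for all }x,y,z\in\mathcal A.$$
   Context: An algebra is a vector space with a bilinear product, not necessarily associative. A $\delta$-mock-Novikov algebra is an algebra $(\mathcal A,\circ)$ such that for all $a,b,c\in\mathcal A$ $$\delta(a\circ b)\circ c+\delta(b\circ a)\circ c+a\circ(b\circ c)+b\circ(a\circ c)=0,\qquad (a\circ b)\circ c+(a\circ c)\circ b=0.$$ A $\delta$-mock-Novikov-Poisson algebra is a triple $(\mathcal A,\ast,\circ)$ where $(\mathcal A,\ast)$ is anti-commutative ($x\ast y=-y\ast x$) and anti-associative ($(x\ast y)\ast z=-x\ast(y\ast z)$), $(\mathcal A,\circ)$ is a $\delta$-mock-Novikov algebra, and for all $x,y,z\in\mathcal A$ $$(x\ast y)\circ z+x\ast(y\circ z)=0,$$ $$\delta(x\circ y)\ast z+\delta(y\circ x)\ast z+x\circ(y\ast z)+y\circ(x\ast z)=0.$$ *)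

theory Defs
  imports Complex_Main
begin

locale nonassoc_algebra = vector_space scale
  for scale :: "'k::field \<Rightarrow> 'a::ab_group_add \<Rightarrow> 'a" (infixr "*s" 75) +
  fixes mult :: "'a \<Rightarrow> 'a \<Rightarrow> 'a" (infixl "\<odot>" 80)
  assumes linear_right: "Vector_Spaces.linear scale scale (\<lambda>y. x \<odot> y)"
    and linear_left: "Vector_Spaces.linear scale scale (\<lambda>x. x \<odot> y)"

text \<open>
  The scalar \<open>\<delta>\<close> is applied to the whole triple product; by bilinearity this is the same as
  applying it to the inner product, as the usual notation \<open>\<delta>(a \<odot> b) \<odot> c\<close> may be read.
\<close>

locale mock_Novikov_algebra = nonassoc_algebra scale mult
  for scale :: "'k::field \<Rightarrow> 'a::ab_group_add \<Rightarrow> 'a" (infixr "*s" 75)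
    and mult :: "'a \<Rightarrow> 'a \<Rightarrow> 'a" (infixl "\<odot>" 80) +
  fixes \<delta> :: 'k
  assumes left_identity:
      "\<delta> *s ((a \<odot> b) \<odot> c) + \<delta> *s ((b \<odot> a) \<odot> c)
        + a \<odot> (b \<odot> c) + b \<odot> (a \<odot> c) = 0"
    and right_identity: "(a \<odot> b) \<odot> c + (a \<odot> c) \<odot> b = 0"

locale mock_Novikov_Poisson_algebra =
  star: nonassoc_algebra scale star + circ: mock_Novikov_algebra scale circ \<delta>
  for scale :: "'k::field \<Rightarrow> 'a::ab_group_add \<Rightarrow> 'a" (infixr "*s" 75)
    and star :: "'a \<Rightarrow> 'a \<Rightarrow> 'a" (infixl "\<ast>" 80)
    and circ :: "'a \<Rightarrow> 'a \<Rightarrow> 'a" (infixl "\<odot>" 80)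
    and \<delta> :: 'k +
  assumes anti_commutative: "x \<ast> y = - (y \<ast> x)"
    and anti_associative: "(x \<ast> y) \<ast> z = - (x \<ast> (y \<ast> z))"
    and compat_star_circ: "(x \<ast> y) \<odot> z + x \<ast> (y \<odot> z) = 0"
    and compat_circ_star:
      "\<delta> *s ((x \<odot> y) \<ast> z) + \<delta> *s ((y \<odot> x) \<ast> z)
        + x \<odot> (y \<ast> z) + y \<odot> (x \<ast> z) = 0"

end

theory Submission
  imports Defs
begin

text \<open>
  Multiplied by \<open>4\<close>, the compatibility \<open>(x \<ast> y) \<odot> z + x \<ast> (y \<odot> z) = 0\<close> is the displayed identity
  modulo the mock-Novikov identities. Conversely, adding the identity to its image under
  \<open>x \<leftrightarrow> z\<close> gives \<open>2\<delta>((xz)y + (zx)y) = 0\<close>, so \<open>(xy)z\<close> is alternating under all permutations of its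
  arguments, and what is left of the identity forces \<open>x(yz) = -(xy)z\<close>. Then every triple product
  involving \<open>\<odot>\<close> vanishes, while \<open>(x \<ast> y) \<ast> z = (xy)z = - x \<ast> (y \<ast> z)\<close>.
\<close>

lemma two_neq_zero_if_CHAR:
  assumes "CHAR('k::field) \<noteq> 2"
  shows "(2::'k) \<noteq> 0"
proof
  assume "(2::'k) = 0"
  then have "of_nat 2 = (0::'k)" by simp
  then have "CHAR('k) dvd 2" by (simp only: of_nat_eq_0_iff_char_dvd)
  then have "CHAR('k) \<le> 2" "CHAR('k) \<noteq> 0" by (auto dest: dvd_imp_le intro!: Nat.gr0I)
  moreover have "CHAR('k) \<noteq> 1" by simp
  ultimately show False using assms by linarith
qed

lemma (in vector_space) double_eq_0D:
  fixes v :: 'b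
  assumes "(2::'a) \<noteq> 0" and "v + v = 0"
  shows "v = 0"
proof -
  have "scale 2 v = v + v"
    by (metis one_add_one scale_left_distrib scale_one)
  then show ?thesis using assms by simp
qed

context nonassoc_algebra
begin

lemma mult_add_right: "x \<odot> (y + z) = x \<odot> y + x \<odot> z"
  and mult_scale_right: "x \<odot> (r *s y) = r *s (x \<odot> y)"
  using linear_right[of x] by (simp_all add: Vector_Spaces.linear_iff)

lemma mult_add_left: "(x + y) \<odot> z = x \<odot> z + y \<odot> z"
  and mult_scale_left: "(r *s x) \<odot> z = r *s (x \<odot> z)"
  using linear_left[of z] by (simp_all add: Vector_Spaces.linear_iff)

lemma mult_minus_right: "x \<odot> (- y) = - (x \<odot> y)"
  using mult_scale_right[of x "- 1" y] by simp

lemma mult_minus_left: "(- x) \<odot> y = - (x \<odot> y)"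
  using mult_scale_left[of "- 1" x y] by simp

lemma mult_diff_right: "x \<odot> (y - z) = x \<odot> y - x \<odot> z"
  using mult_add_right[of x y "- z"] by (simp add: mult_minus_right)

lemma mult_diff_left: "(x - y) \<odot> z = x \<odot> z - y \<odot> z"
  using mult_add_left[of x "- y" z] by (simp add: mult_minus_left)

lemmas mult_linear_simps =
  mult_add_right mult_add_left mult_diff_right mult_diff_left
  mult_minus_right mult_minus_left mult_scale_right mult_scale_left

text \<open>Serves both new products: coefficients \<open>h\<close>, \<open>- h\<close> give the
  star product and \<open>h\<close>, \<open>h\<close> the circle product.\<close>

lemma nonassoc_algebra_combination:
  assumes "\<And>x y. f x y = p *s (x \<odot> y) + q *s (y \<odot> x)"
  shows "nonassoc_algebra scale f"
proof (intro nonassoc_algebra.intro nonassoc_algebra_axioms.intro vector_space_axioms)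
  fix x y
  show "Vector_Spaces.linear scale scale (\<lambda>y. f x y)"
    "Vector_Spaces.linear scale scale (\<lambda>x. f x y)"
    by (auto simp: Vector_Spaces.linear_iff vector_space_axioms assms mult_linear_simps scale_right_distrib
        mult.commute)
qed

end

context mock_Novikov_algebra
begin

definition cyclic_compat :: bool where
  "cyclic_compat \<longleftrightarrow> (\<forall>x y z. x \<odot> (y \<odot> z) - z \<odot> (y \<odot> x)
      - (1 + \<delta>) *s ((x \<odot> z) \<odot> y) + (1 - \<delta>) *s ((z \<odot> x) \<odot> y) = 0)"

lemma right_swap: "(a \<odot> b) \<odot> c = - ((a \<odot> c) \<odot> b)"
  using right_identity[of a b c] by (simp add: eq_neg_iff_add_eq_0)

text \<open>The left side is the star-circle compatibility cleared of its factors 1/2. The left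
  identity rewrites the product of \<open>z\<close> with \<open>x \<odot> y\<close>, cancelling
  \<open>x \<odot> (z \<odot> y)\<close>; \<open>right_swap\<close> merges the left-nested
  products.\<close>

lemma compat_expansion:
  "(x \<odot> y - y \<odot> x) \<odot> z + z \<odot> (x \<odot> y - y \<odot> x)
      + (x \<odot> (y \<odot> z + z \<odot> y) - (y \<odot> z + z \<odot> y) \<odot> x)
    = x \<odot> (y \<odot> z) - z \<odot> (y \<odot> x)
      - (1 + \<delta>) *s ((x \<odot> z) \<odot> y) + (1 - \<delta>) *s ((z \<odot> x) \<odot> y)"
proof -
  have l: "z \<odot> (x \<odot> y) = - (\<delta> *s ((x \<odot> z) \<odot> y)) - \<delta> *s ((z \<odot> x) \<odot> y) - x \<odot> (z \<odot> y)"
  proof -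
    have "z \<odot> (x \<odot> y) - (- (\<delta> *s ((x \<odot> z) \<odot> y)) - \<delta> *s ((z \<odot> x) \<odot> y) - x \<odot> (z \<odot> y)) = 0"
      using left_identity[of x z y] by (simp add: algebra_simps)
    then show ?thesis by (simp only: right_minus_eq)
  qed
  show ?thesis
    unfolding l mult_linear_simps scale_left_distrib scale_left_diff_distrib
    using right_swap[of x y z] right_swap[of y x z] right_swap[of z x y]
    by (simp add: algebra_simps l)
qed

context
  assumes two: "(2::'k) \<noteq> 0" and delta: "\<delta> \<noteq> 0" and compat: cyclic_compat
begin

text \<open>Exchanging the outer arguments cancels the right-nested products and leaves a multiple
  of \<open>?v\<close> by -2\<delta>, so both 2 and \<delta> must be cancelled.\<close>

lemma left_swap: "(x \<odot> y) \<odot> z = - ((y \<odot> x) \<odot> z)"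
proof -
  let ?v = "(x \<odot> y) \<odot> z + (y \<odot> x) \<odot> z"
  let ?e = "\<lambda>x z y. x \<odot> (y \<odot> z) - z \<odot> (y \<odot> x)
      - (1 + \<delta>) *s ((x \<odot> z) \<odot> y) + (1 - \<delta>) *s ((z \<odot> x) \<odot> y)"
  have "\<delta> *s ?v + \<delta> *s ?v = - (?e x y z + ?e y x z)"
    by (simp add: algebra_simps)
  also have "\<dots> = 0"
    using compat by (simp add: cyclic_compat_def)
  finally have "\<delta> *s ?v + \<delta> *s ?v = 0" .
  from double_eq_0D[OF two this] have "?v = 0"
    using delta by (simp only: scale_eq_0_iff simp_thms)
  then show ?thesis by (simp add: eq_neg_iff_add_eq_0)
qed

text \<open>By \<open>left_swap\<close> the \<delta>-terms of the left identity cancel.\<close>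

lemma inner_left_swap: "x \<odot> (y \<odot> z) = - (y \<odot> (x \<odot> z))"
  using left_identity[of x y z] left_swap[of x y z] by (simp add: eq_neg_iff_add_eq_0)

lemma right_eq_minus_left: "x \<odot> (y \<odot> z) = - ((x \<odot> y) \<odot> z)"
proof -
  \<comment> \<open>After the swaps the coefficients -(1 + \<delta>) and -(1 - \<delta>) meet on the
    same product, so \<delta> drops out.\<close>
  have sum: "a \<odot> (b \<odot> c) + b \<odot> (c \<odot> a) + ((a \<odot> b) \<odot> c + (a \<odot> b) \<odot> c) = 0" for a b c
    using compat[unfolded cyclic_compat_def, rule_format, of a b c]
      inner_left_swap[of c b a] left_swap[of c a b] right_swap[of a c b]
    by (simp add: algebra_simps)
  \<comment> \<open>A cyclic shift is a composite of two transpositions, so the signs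
    cancel.\<close>
  have cyc: "(y \<odot> z) \<odot> x = (x \<odot> y) \<odot> z" "(z \<odot> x) \<odot> y = (x \<odot> y) \<odot> z"
    using left_swap right_swap by (metis minus_minus)+
  let ?v = "x \<odot> (y \<odot> z) + (x \<odot> y) \<odot> z"
  let ?s = "\<lambda>a b c. a \<odot> (b \<odot> c) + b \<odot> (c \<odot> a) + ((a \<odot> b) \<odot> c + (a \<odot> b) \<odot> c)"
  \<comment> \<open>Each instance of \<open>sum\<close> contains two of the three cyclic shifts of
    the right-nested product; this signed combination isolates one of them.\<close>
  have "?v + ?v = ?s x y z + ?s z x y - ?s y z x"
    by (simp add: cyc algebra_simps)
  then have "?v + ?v = 0" by (simp only: sum) simp
  from double_eq_0D[OF two this] show ?thesis
    by (simp only: eq_neg_iff_add_eq_0)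
qed

end

end

theorem proposition6p4:
  fixes scale :: "'k::field \<Rightarrow> 'a::ab_group_add \<Rightarrow> 'a" (infixr "*s" 75)
    and mult :: "'a \<Rightarrow> 'a \<Rightarrow> 'a" (infixl "\<cdot>" 80)
    and star :: "'a \<Rightarrow> 'a \<Rightarrow> 'a" (infixl "\<ast>" 80)
    and circ :: "'a \<Rightarrow> 'a \<Rightarrow> 'a" (infixl "\<odot>" 80)
    and \<delta> :: 'k
  assumes "CHAR('k) \<noteq> 2"
    and "\<delta> \<noteq> 0"
    and "mock_Novikov_algebra scale mult \<delta>"
    and "\<And>x y. x \<ast> y = (1 / 2) *s (x \<cdot> y - y \<cdot> x)"
    and "\<And>x y. x \<odot> y = (1 / 2) *s (x \<cdot> y + y \<cdot> x)"
  shows "mock_Novikov_Poisson_algebra scale star circ \<delta> \<longleftrightarrow>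
    (\<forall>x y z. x \<cdot> (y \<cdot> z) - z \<cdot> (y \<cdot> x)
      - (1 + \<delta>) *s ((x \<cdot> z) \<cdot> y) + (1 - \<delta>) *s ((z \<cdot> x) \<cdot> y) = 0)"
proof -
  interpret mock_Novikov_algebra scale mult \<delta> by fact
  note star = assms(4) and circ = assms(5)
  define h :: 'k where "h = 1 / 2"
  have two: "(2::'k) \<noteq> 0" using assms(1) by (rule two_neq_zero_if_CHAR)
  then have h: "h \<noteq> 0" by (simp add: h_def)
  have star_h: "x \<ast> y = h *s (x \<cdot> y - y \<cdot> x)" for x y using star by (simp add: h_def)
  have circ_h: "x \<odot> y = h *s (x \<cdot> y + y \<cdot> x)" for x y using circ by (simp add: h_def)
  \<comment> \<open>Since \<open>h * h\<close> is nonzero, the first compatibility axiom is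
    equivalent to the identity, which settles the forward direction.\<close>
  have compat_hh: "(x \<ast> y) \<odot> z + x \<ast> (y \<odot> z) = (h * h) *s (x \<cdot> (y \<cdot> z) - z \<cdot> (y \<cdot> x)
      - (1 + \<delta>) *s ((x \<cdot> z) \<cdot> y) + (1 - \<delta>) *s ((z \<cdot> x) \<cdot> y))" for x y z
    unfolding compat_expansion[symmetric] star_h circ_h
    by (simp add: mult_linear_simps algebra_simps)
  have "mock_Novikov_Poisson_algebra scale star circ \<delta> \<longleftrightarrow> cyclic_compat"
  proof
    assume "mock_Novikov_Poisson_algebra scale star circ \<delta>"
    then interpret P: mock_Novikov_Poisson_algebra scale star circ \<delta> .
    show cyclic_compat
      using compat_hh P.compat_star_circ h unfolding cyclic_compat_def by simp
  next
    assume compat: cyclic_compat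
    note swap = left_swap[OF two assms(2) compat]
    note assoc = right_eq_minus_left[OF two assms(2) compat]
    interpret S: nonassoc_algebra scale star
      by (rule nonassoc_algebra_combination[of _ h "- h"])
        (simp add: star_h scale_right_diff_distrib)
    interpret C: nonassoc_algebra scale circ
      by (rule nonassoc_algebra_combination[of _ h h]) (simp add: circ_h scale_right_distrib)
    \<comment> \<open>A symmetrised pair is killed by the alternating triple product;
      \<open>assoc\<close> reduces right nesting to left nesting.\<close>
    have circ_inner: "x \<cdot> (y \<odot> z) = 0" "(y \<odot> z) \<cdot> x = 0" for x y z
      using swap[of y z x] right_swap[of x y z]
      by (simp_all add: circ_h mult_linear_simps assoc)
    have cyc: "(y \<cdot> z) \<cdot> x = (x \<cdot> y) \<cdot> z" for x y z
      using swap right_swap by (metis minus_minus)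
    have hh: "h + h = 1" using two by (simp add: h_def field_simps)
    have half: "h *s (v + v) = v" for v
      by (metis hh scale_left_distrib scale_one scale_right_distrib)
    have half_minus: "h *s (- v - v) = - v" for v
      using half[of "- v"] by simp
    \<comment> \<open>By alternation the two halves of an antisymmetrised pair agree, so an inner
      star acts like the original product.\<close>
    have star_inner: "(y \<ast> z) \<cdot> x = (x \<cdot> y) \<cdot> z" "x \<cdot> (y \<ast> z) = - ((x \<cdot> y) \<cdot> z)" for x y z
      using swap[of z y x] cyc[of y z x] right_swap[of x z y] half half_minus
      by (simp_all add: star_h mult_linear_simps assoc)
    have star3: "(x \<ast> y) \<ast> z = (x \<cdot> y) \<cdot> z" "x \<ast> (y \<ast> z) = - ((x \<cdot> y) \<cdot> z)" for x y z
      using half half_minus cyc[of x y z] cyc[of z x y]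
      by (simp_all add: star_h[of "x \<ast> y"] star_h[of _ "y \<ast> z"] star_inner)
    \<comment> \<open>An inner circle vanishes by \<open>circ_inner\<close>. For an inner star under
      an outer circle, the two values in \<open>star_inner\<close> are opposite and cancel.\<close>
    have zero: "(x \<odot> y) \<ast> z = 0" "x \<ast> (y \<odot> z) = 0" "(x \<odot> y) \<odot> z = 0" "x \<odot> (y \<odot> z) = 0"
      "x \<odot> (y \<ast> z) = 0" "(x \<ast> y) \<odot> z = 0" for x y z
      by (simp_all add: star_h[of "x \<odot> y"] star_h[of _ "y \<odot> z"] circ_h[of "x \<odot> y"]
          circ_h[of _ "y \<odot> z"] circ_h[of _ "y \<ast> z"] circ_h[of "x \<ast> y"] circ_inner star_inner)
    show "mock_Novikov_Poisson_algebra scale star circ \<delta>"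
    proof
      show "x \<ast> y = - (y \<ast> x)" for x y
        by (simp add: star_h flip: scale_minus_right)
    \<comment> \<open>Anti-associativity is \<open>star3\<close>; in each other remaining axiom
      every term vanishes by \<open>zero\<close>.\<close>
    qed (simp_all add: zero star3)
  qed
  then show ?thesis unfolding cyclic_compat_def .
qed

end
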